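(* Let $\alpha>0$, $\alpha\ne1$. (1) For a $k$-parameter regular $\mathbb{M}^{(\alpha)}$-family characterized by $h,w,f,\Theta,\mathbb{S}$, the statistic $\overline f/\overline h=\big[\overline{f_1}/\overline h,\dots,\overline{f_k}/\overline h\big]^\top$ is a minimal sufficient statistic for $\theta$ with respect to the Jones et al. likelihood function $L_J^{(\alpha)}$. (2) For a $k$-parameter regular $\mathbb{B}^{(\alpha)}$-family characterized by $h,w,f,\Theta,\mathbb{S}$, the statistic $\overline f=\big[\overline{f_1},\dots,\overline{f_k}\big]^\top$ is a minimal sufficient statistic for $\theta$ with respect to the Basu et al. likelihood function $L_B^{(\alpha)}$.
   Context: For a sample $x_1^n=x_1,\dots,x_n$, $\overline{f_i}=\frac1n\sum_{j=1}^n f_i(x_j)$ and $\overline h=\frac1n\sum_{j=1}^n h(x_j)$. Let $\Theta$ be an open subset of $\mathbb{R}^k$, $w=[w_1,\dots,w_s]^\top$ with $w_i:\Theta\to\mathbb{R}$ differentiable, $f=[f_1,\dots,f_s]^\top$ with $f_i:\mathbb{R}\to\mathbb{R}$, $h:\mathbb{R}\to\mathbb{R}$, $\mathbb{S}\subseteq\mathbb{R}$. A $k$-parameter $\mathbb{M}^{(\alpha)}$-family characterized by these is $\{p_\theta:\theta\in\Theta\}$ with $p_\theta(x)=Z(\theta)[h(x)+w(\theta)^\top f(x)]^{\frac1{\alpha-1}}$ for $x\in\mathbb{S}$ and $p_\theta(x)=0$ otherwise, where $Z(\theta)^{-1}=\int_{\mathbb{S}}[h(x)+w(\theta)^\top f(x)]^{\frac1{\alpha-1}}dx$.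 A $k$-parameter $\mathbb{B}^{(\alpha)}$-family characterized by these is $\{p_\theta:\theta\in\Theta\}$ with $p_\theta(x)=[h(x)+F(\theta)+w(\theta)^\top f(x)]^{\frac1{\alpha-1}}$ for $x\in\mathbb{S}$ and $p_\theta(x)=0$ otherwise, for some $F:\Theta\to\mathbb{R}$ (the normalizing factor). An $\mathbb{M}^{(\alpha)}$-family is regular if (i) the support $\mathbb{S}$ does not depend on $\theta$; (ii) $s=k$; (iii) $1,w_1,\dots,w_k$ are linearly independent; (iv) $f_1,\dots,f_k$ are linearly independent. A $\mathbb{B}^{(\alpha)}$-family is regular if (i)–(iii) hold and $1,f_1,\dots,f_k$ are linearly independent. Likelihood functions: $$L_J^{(\alpha)}(x_1^n;\theta)=\frac{1}{\alpha-1}\log\Big[\frac1n\sum_{i=1}^n p_\theta(x_i)^{\alpha-1}\Big]-\frac1\alpha\log\Big[\int p_\theta(x)^\alpha dx\Big],$$ $$L_B^{(\alpha)}(x_1^n;\theta)=\frac1n\sum_{i=1}^n\Big[\frac{\alpha\, p_\theta(x_i)^{\alpha-1}-1}{\alpha-1}\Big]-\int p_\theta(x)^\alpha dx.$$ A statistic $T$ is sufficient for $\theta$ with respect to a likelihood function $L_G$ if, whenever $T(x_1^n)=T(y_1^n)$, $L_G(x_1^n;\theta)-L_G(y_1^n;\theta)$ is independent of $\theta\in\Theta$. A sufficient statistic $T$ (with respect to $L_G$) is minimal if it is a function of any other sufficient statistic (with respect to $L_G$): for any sufficient $\widetilde T$ and any samples $x_1^n,y_1^n$, $\widetilde T(x_1^n)=\widetilde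 T(y_1^n)$ implies $T(x_1^n)=T(y_1^n)$. *)

theory Defs
  imports "HOL-Analysis.Analysis"
begin

text \<open>
  Linear independence of an indexed family of real functions on a common domain \<open>D\<close>
  (repeated members make the family dependent).
\<close>

definition lin_indep_on :: "'a set \<Rightarrow> ('i::finite \<Rightarrow> 'a \<Rightarrow> real) \<Rightarrow> bool" where
  "lin_indep_on D g \<longleftrightarrow>
     (\<forall>c :: 'i \<Rightarrow> real. (\<forall>x\<in>D. (\<Sum>i\<in>UNIV. c i * g i x) = 0) \<longrightarrow> (\<forall>i. c i = 0))"

definition with_one :: "('a \<Rightarrow> real ^ 's) \<Rightarrow> 's option \<Rightarrow> 'a \<Rightarrow> real" where
  "with_one g j x = (case j of None \<Rightarrow> 1 | Some i \<Rightarrow> g x $ i)"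

definition is_density :: "(real \<Rightarrow> real) \<Rightarrow> bool" where
  "is_density p \<longleftrightarrow>
     (\<forall>x. 0 \<le> p x) \<and> integrable lebesgue p \<and> (LINT x|lebesgue. p x) = 1"

text \<open>
  In both families below, the bases of the powers are required to be nonnegative on \<open>S\<close>,
  because \<open>powr\<close> has no mathematical meaning at negative bases. Requiring the members to be
  densities makes the integral defining \<open>Z \<theta>\<close> finite and nonzero, and makes \<open>F\<close> the
  normalizing factor.
\<close>

definition M_norm ::
  "real \<Rightarrow> (real \<Rightarrow> real) \<Rightarrow> (real ^ 'k \<Rightarrow> real ^ 's) \<Rightarrow> (real \<Rightarrow> real ^ 's)
    \<Rightarrow> real set \<Rightarrow> real ^ 'k \<Rightarrow> real" where
  "M_norm \<alpha> h w f S \<theta> =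
     inverse (LINT x:S|lebesgue. (h x + w \<theta> \<bullet> f x) powr (1 / (\<alpha> - 1)))"

definition M_family ::
  "real \<Rightarrow> (real \<Rightarrow> real) \<Rightarrow> (real ^ 'k \<Rightarrow> real ^ 's) \<Rightarrow> (real \<Rightarrow> real ^ 's)
    \<Rightarrow> (real ^ 'k) set \<Rightarrow> real set \<Rightarrow> (real ^ 'k \<Rightarrow> real \<Rightarrow> real) \<Rightarrow> bool" where
  "M_family \<alpha> h w f \<Theta> S p \<longleftrightarrow>
     open \<Theta> \<and>
     (\<forall>i. (\<lambda>\<theta>. w \<theta> $ i) differentiable_on \<Theta>) \<and>
     (\<forall>\<theta>\<in>\<Theta>. \<forall>x\<in>S. 0 \<le> h x + w \<theta> \<bullet> f x) \<and>
     (\<forall>\<theta>\<in>\<Theta>. \<forall>x. p \<theta> x =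
        (if x \<in> S then M_norm \<alpha> h w f S \<theta> * (h x + w \<theta> \<bullet> f x) powr (1 / (\<alpha> - 1)) else 0)) \<and>
     (\<forall>\<theta>\<in>\<Theta>. is_density (p \<theta>))"

definition B_family ::
  "real \<Rightarrow> (real \<Rightarrow> real) \<Rightarrow> (real ^ 'k \<Rightarrow> real ^ 's) \<Rightarrow> (real \<Rightarrow> real ^ 's)
    \<Rightarrow> (real ^ 'k) set \<Rightarrow> real set \<Rightarrow> (real ^ 'k \<Rightarrow> real \<Rightarrow> real) \<Rightarrow> bool" where
  "B_family \<alpha> h w f \<Theta> S p \<longleftrightarrow>
     open \<Theta> \<and>
     (\<forall>i. (\<lambda>\<theta>. w \<theta> $ i) differentiable_on \<Theta>) \<and>
     (\<exists>F :: real ^ 'k \<Rightarrow> real.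
        (\<forall>\<theta>\<in>\<Theta>. \<forall>x\<in>S. 0 \<le> h x + F \<theta> + w \<theta> \<bullet> f x) \<and>
        (\<forall>\<theta>\<in>\<Theta>. \<forall>x. p \<theta> x =
           (if x \<in> S then (h x + F \<theta> + w \<theta> \<bullet> f x) powr (1 / (\<alpha> - 1)) else 0))) \<and>
     (\<forall>\<theta>\<in>\<Theta>. is_density (p \<theta>))"

text \<open>
  The support of a density \<open>p\<close> is \<open>{x. 0 < p x}\<close>. The functions \<open>w\<^sub>i\<close> are linearly independent
  as functions on \<open>\<Theta>\<close>, the functions \<open>f\<^sub>i\<close> as functions on the whole real line (which is
  implied by independence on \<open>S\<close>).
\<close>

definition regular_M_family ::
  "real \<Rightarrow> (real \<Rightarrow> real) \<Rightarrow> (real ^ 'k \<Rightarrow> real ^ 's) \<Rightarrow> (real \<Rightarrow> real ^ 's)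
    \<Rightarrow> (real ^ 'k) set \<Rightarrow> real set \<Rightarrow> (real ^ 'k \<Rightarrow> real \<Rightarrow> real) \<Rightarrow> bool" where
  "regular_M_family \<alpha> h w f \<Theta> S p \<longleftrightarrow>
     M_family \<alpha> h w f \<Theta> S p \<and>
     (\<forall>\<theta>\<in>\<Theta>. {x. 0 < p \<theta> x} = S) \<and>
     CARD('s) = CARD('k) \<and>
     lin_indep_on \<Theta> (with_one w) \<and>
     lin_indep_on UNIV (\<lambda>i x. f x $ i)"

definition regular_B_family ::
  "real \<Rightarrow> (real \<Rightarrow> real) \<Rightarrow> (real ^ 'k \<Rightarrow> real ^ 's) \<Rightarrow> (real \<Rightarrow> real ^ 's)
    \<Rightarrow> (real ^ 'k) set \<Rightarrow> real set \<Rightarrow> (real ^ 'k \<Rightarrow> real \<Rightarrow> real) \<Rightarrow> bool" where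
  "regular_B_family \<alpha> h w f \<Theta> S p \<longleftrightarrow>
     B_family \<alpha> h w f \<Theta> S p \<and>
     (\<forall>\<theta>\<in>\<Theta>. {x. 0 < p \<theta> x} = S) \<and>
     CARD('s) = CARD('k) \<and>
     lin_indep_on \<Theta> (with_one w) \<and>
     lin_indep_on UNIV (with_one f)"

text \<open>A sample of size \<open>n\<close> is a vector in \<open>real ^ 'n\<close> with \<open>CARD('n) = n\<close>.\<close>

definition sample_mean :: "(real \<Rightarrow> real) \<Rightarrow> real ^ 'n \<Rightarrow> real" where
  "sample_mean g x = (\<Sum>j\<in>UNIV. g (x $ j)) / real CARD('n)"

definition sample_mean_vec :: "(real \<Rightarrow> real ^ 's) \<Rightarrow> real ^ 'n \<Rightarrow> real ^ 's" where
  "sample_mean_vec f x = (\<chi> i. sample_mean (\<lambda>t. f t $ i) x)"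

definition jones_likelihood ::
  "real \<Rightarrow> ('p \<Rightarrow> real \<Rightarrow> real) \<Rightarrow> real ^ 'n \<Rightarrow> 'p \<Rightarrow> real" where
  "jones_likelihood \<alpha> p x \<theta> =
     1 / (\<alpha> - 1) * ln (sample_mean (\<lambda>t. p \<theta> t powr (\<alpha> - 1)) x)
     - 1 / \<alpha> * ln (LINT t|lebesgue. p \<theta> t powr \<alpha>)"

definition basu_likelihood ::
  "real \<Rightarrow> ('p \<Rightarrow> real \<Rightarrow> real) \<Rightarrow> real ^ 'n \<Rightarrow> 'p \<Rightarrow> real" where
  "basu_likelihood \<alpha> p x \<theta> =
     sample_mean (\<lambda>t. (\<alpha> * p \<theta> t powr (\<alpha> - 1) - 1) / (\<alpha> - 1)) x
     - (LINT t|lebesgue. p \<theta> t powr \<alpha>)"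

definition sufficient_statistic ::
  "'x set \<Rightarrow> 'p set \<Rightarrow> ('x \<Rightarrow> 'p \<Rightarrow> real) \<Rightarrow> ('x \<Rightarrow> 't) \<Rightarrow> bool" where
  "sufficient_statistic X \<Theta> L T \<longleftrightarrow>
     (\<forall>x\<in>X. \<forall>y\<in>X. T x = T y \<longrightarrow> (\<exists>c. \<forall>\<theta>\<in>\<Theta>. L x \<theta> - L y \<theta> = c))"

text \<open>
  The competing statistics take values in the type given by the first argument. A theorem
  with conclusion \<open>minimal_sufficient_statistic TYPE('u) \<dots>\<close> and \<open>'u\<close> a free type variable
  covers competitors with arbitrary values.
\<close>

definition minimal_sufficient_statistic ::
  "'u itself \<Rightarrow> 'x set \<Rightarrow> 'p set \<Rightarrow> ('x \<Rightarrow> 'p \<Rightarrow> real) \<Rightarrow> ('x \<Rightarrow> 't) \<Rightarrow> bool" where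
  "minimal_sufficient_statistic _ X \<Theta> L T \<longleftrightarrow>
     sufficient_statistic X \<Theta> L T \<and>
     (\<forall>T' :: 'x \<Rightarrow> 'u. sufficient_statistic X \<Theta> L T' \<longrightarrow>
        (\<forall>x\<in>X. \<forall>y\<in>X. T' x = T' y \<longrightarrow> T x = T y))"

definition samples :: "real set \<Rightarrow> (real ^ 'n) set" where
  "samples S = {x. \<forall>j. x $ j \<in> S}"

text \<open>The samples at which a quotient by the sample mean of \<open>h\<close> is defined.\<close>

definition samples_nz :: "(real \<Rightarrow> real) \<Rightarrow> real set \<Rightarrow> (real ^ 'n) set" where
  "samples_nz h S = {x \<in> samples S. sample_mean h x \<noteq> 0}"

end

theory Submission
  imports Defs
begin

text \<open>
  On the support \<open>p \<theta> x powr (\<alpha> - 1)\<close> is affine in \<open>w \<theta>\<close>, so up to terms in \<open>\<theta>\<close> alone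
  the likelihood of a sample depends on it through \<open>ln (h' + w \<theta> \<bullet> f')\<close> (Jones et al.) or through
  \<open>h' + w \<theta> \<bullet> f'\<close> (Basu et al.), where \<open>h'\<close> and \<open>f'\<close> are the sample means. Differences of
  likelihoods are thus constant in \<open>\<theta>\<close> iff the affine forms of the two samples are proportional,
  respectively differ by a constant. As \<open>1, w\<^sub>1, \<dots>, w\<^sub>k\<close> are linearly independent, coefficients
  may be compared.
\<close>

text \<open>From right to left the equivalence says nothing about \<open>T'\<close> yet: a
  sufficient \<open>T'\<close> with \<open>T' x = T' y\<close> makes the likelihood difference
  constant, and this direction turns that into \<open>T x = T y\<close>. From left to right it is
  sufficiency of \<open>T\<close>.\<close>

lemma minimal_sufficient_statisticI:
  assumes "\<And>x y. x \<in> X \<Longrightarrow> y \<in> X \<Longrightarrow> T x = T y \<longleftrightarrow> (\<exists>c. \<forall>\<theta>\<in>\<Theta>. L x \<theta> - L y \<theta> = c)"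
  shows "minimal_sufficient_statistic TYPE('u) X \<Theta> L T"
  using assms unfolding minimal_sufficient_statistic_def sufficient_statistic_def by blast

text \<open>This is the form in which coefficients get compared: intercept \<open>a\<close> and
  vector \<open>v\<close> are packed into one coefficient family, with index \<open>None\<close>
  carrying the constant function 1.\<close>

lemma lin_indep_on_with_oneD:
  fixes w :: "'a \<Rightarrow> real ^ 's"
  assumes "lin_indep_on D (with_one w)" and "\<And>x. x \<in> D \<Longrightarrow> a + w x \<bullet> v = 0"
  shows "a = 0" and "v = 0"
proof -
  define c where "c j = (case j of None \<Rightarrow> a | Some i \<Rightarrow> v $ i)" for j
  have "(\<Sum>j\<in>UNIV. c j * with_one w j x) = a + w x \<bullet> v" for x
    by (simp add: UNIV_option_conv sum.reindex c_def with_one_def inner_vec_def mult.commute)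
  then have c0: "c j = 0" for j
    using assms unfolding lin_indep_on_def by simp
  show "a = 0" using c0[of None] by (simp add: c_def)
  show "v = 0" using c0[of "Some i" for i] by (simp add: c_def vec_eq_iff)
qed

lemma sample_mean_cong:
  assumes "x \<in> samples S" and "\<And>t. t \<in> S \<Longrightarrow> g t = g' t"
  shows "sample_mean g x = sample_mean g' x"
  using assms by (simp add: sample_mean_def samples_def)

lemma sample_mean_add:
  "sample_mean (\<lambda>t. g t + g' t) x = sample_mean g x + sample_mean g' x"
  by (simp add: sample_mean_def sum.distrib add_divide_distrib)

lemma sample_mean_cmult:
  "sample_mean (\<lambda>t. c * g t) x = c * sample_mean g x"
  by (simp add: sample_mean_def sum_distrib_left)

lemma sample_mean_const: "sample_mean (\<lambda>t. c) x = c"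
  by (simp add: sample_mean_def)

lemma sample_mean_inner:
  "sample_mean (\<lambda>t. v \<bullet> f t) x = v \<bullet> sample_mean_vec f x"
proof -
  have "(\<Sum>j\<in>UNIV. v \<bullet> f (x $ j)) = (\<Sum>i\<in>UNIV. v $ i * (\<Sum>j\<in>UNIV. f (x $ j) $ i))"
    unfolding inner_vec_def inner_real_def sum_distrib_left by (rule sum.swap)
  then show ?thesis
    by (simp add: sample_mean_def sample_mean_vec_def inner_vec_def flip: sum_divide_distrib)
qed

lemma sample_mean_pos:
  assumes "x \<in> samples S" and "\<And>t. t \<in> S \<Longrightarrow> 0 < g t"
  shows "0 < sample_mean g x"
  using assms by (auto simp: sample_mean_def samples_def intro!: divide_pos_pos sum_pos)

text \<open>Positivity comes from \<open>S\<close> being the support: at \<open>t\<close> in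
  \<open>S\<close> the product of the normalizer and the power is positive, and the power is
  nonnegative. The exponents \<open>1 / (\<alpha> - 1)\<close> and \<open>\<alpha> - 1\<close> then
  cancel.\<close>

lemma regular_M_family_affine:
  assumes "regular_M_family \<alpha> h w f \<Theta> S p" and "\<alpha> \<noteq> 1" and "\<theta> \<in> \<Theta>" and "t \<in> S"
  shows "0 < M_norm \<alpha> h w f S \<theta>" and "0 < h t + w \<theta> \<bullet> f t"
    and "p \<theta> t powr (\<alpha> - 1) = M_norm \<alpha> h w f S \<theta> powr (\<alpha> - 1) * (h t + w \<theta> \<bullet> f t)"
proof -
  let ?Z = "M_norm \<alpha> h w f S \<theta>" and ?b = "h t + w \<theta> \<bullet> f t"
  have b: "0 \<le> ?b" and p: "p \<theta> t = ?Z * ?b powr (1 / (\<alpha> - 1))"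
    using assms(1,3,4) unfolding regular_M_family_def M_family_def by simp_all
  have "{x. 0 < p \<theta> x} = S"
    using assms(1,3) unfolding regular_M_family_def by blast
  then have "0 < p \<theta> t" using assms(4) by blast
  then have pos: "0 < ?Z * ?b powr (1 / (\<alpha> - 1))" by (simp only: p)
  show "0 < ?Z" using pos by (simp add: zero_less_mult_iff)
  \<comment> \<open>\<open>0 powr a\<close> is 0 for every \<open>a\<close>, negative exponents
    included, so a zero base would make the density vanish at \<open>t\<close>.\<close>
  show "0 < ?b" using pos b by (cases "?b = 0") auto
  show "p \<theta> t powr (\<alpha> - 1) = ?Z powr (\<alpha> - 1) * ?b"
    using \<open>0 < ?Z\<close> b \<open>\<alpha> \<noteq> 1\<close> by (simp add: p powr_mult powr_powr)
qed

text \<open>The power of the normalizer factors out of the sample mean, and the logarithm splits it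
  off. The last summand thus depends on \<open>\<theta>\<close> alone and cancels when two samples
  are compared.\<close>

lemma jones_likelihood_M_family:
  fixes x :: "real ^ 'n"
  assumes "regular_M_family \<alpha> h w f \<Theta> S p" and "\<alpha> \<noteq> 1" and "\<theta> \<in> \<Theta>" and "x \<in> samples S"
  shows "0 < sample_mean h x + w \<theta> \<bullet> sample_mean_vec f x"
    and "jones_likelihood \<alpha> p x \<theta> =
      ln (sample_mean h x + w \<theta> \<bullet> sample_mean_vec f x) / (\<alpha> - 1)
      + (ln (M_norm \<alpha> h w f S \<theta>) - 1 / \<alpha> * ln (LINT t|lebesgue. p \<theta> t powr \<alpha>))"
proof -
  let ?Z = "M_norm \<alpha> h w f S \<theta>" and ?m = "sample_mean h x + w \<theta> \<bullet> sample_mean_vec f x"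
  note affine = regular_M_family_affine[OF assms(1-3)]
  have m: "sample_mean (\<lambda>t. h t + w \<theta> \<bullet> f t) x = ?m"
    by (simp add: sample_mean_add sample_mean_inner)
  show pos: "0 < ?m"
    using sample_mean_pos[OF assms(4), of "\<lambda>t. h t + w \<theta> \<bullet> f t"] affine(2) m by simp
  \<comment> \<open>Index types are inhabited, so a sample has an entry, which lies in
    \<open>S\<close>; positivity of the normalizer is read off at such a point.\<close>
  have "S \<noteq> {}" using assms(4) by (auto simp: samples_def)
  then have Z: "0 < ?Z" using affine(1) by blast
  have "sample_mean (\<lambda>t. p \<theta> t powr (\<alpha> - 1)) x
      = sample_mean (\<lambda>t. ?Z powr (\<alpha> - 1) * (h t + w \<theta> \<bullet> f t)) x"
    by (rule sample_mean_cong[OF assms(4) affine(3)])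
  also have "\<dots> = ?Z powr (\<alpha> - 1) * ?m"
    by (simp add: sample_mean_cmult m)
  finally have "ln (sample_mean (\<lambda>t. p \<theta> t powr (\<alpha> - 1)) x) = (\<alpha> - 1) * ln ?Z + ln ?m"
    using Z pos by (simp add: ln_mult ln_powr)
  then show "jones_likelihood \<alpha> p x \<theta> = ln ?m / (\<alpha> - 1)
      + (ln ?Z - 1 / \<alpha> * ln (LINT t|lebesgue. p \<theta> t powr \<alpha>))"
    using \<open>\<alpha> \<noteq> 1\<close> by (simp add: jones_likelihood_def field_simps)
qed

text \<open>Exponentiating a constant difference \<open>c\<close> makes the two affine forms
  proportional with ratio \<open>exp c\<close>. By independence intercepts and vectors have this
  same ratio, which cancels in the quotients.\<close>

lemma ln_diff_const_iff:
  fixes w :: "'a \<Rightarrow> real ^ 's"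
  assumes indep: "lin_indep_on D (with_one w)" and "a \<noteq> 0" and "b \<noteq> 0"
    and u: "\<And>\<theta>. \<theta> \<in> D \<Longrightarrow> 0 < a + w \<theta> \<bullet> u" and v: "\<And>\<theta>. \<theta> \<in> D \<Longrightarrow> 0 < b + w \<theta> \<bullet> v"
  shows "(\<exists>c. \<forall>\<theta>\<in>D. ln (a + w \<theta> \<bullet> u) - ln (b + w \<theta> \<bullet> v) = c) \<longleftrightarrow> u /\<^sub>R a = v /\<^sub>R b"
proof
  assume "\<exists>c. \<forall>\<theta>\<in>D. ln (a + w \<theta> \<bullet> u) - ln (b + w \<theta> \<bullet> v) = c"
  then obtain c where c: "ln (a + w \<theta> \<bullet> u) - ln (b + w \<theta> \<bullet> v) = c" if "\<theta> \<in> D" for \<theta>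
    by blast
  have "(a - exp c * b) + w \<theta> \<bullet> (u - exp c *\<^sub>R v) = 0" if "\<theta> \<in> D" for \<theta>
  proof -
    have "exp c = (a + w \<theta> \<bullet> u) / (b + w \<theta> \<bullet> v)"
      using u[OF that] v[OF that] by (simp add: c[OF that, symmetric] exp_diff)
    then have "exp c * (b + w \<theta> \<bullet> v) = a + w \<theta> \<bullet> u"
      using v[OF that] by simp
    then show ?thesis by (simp add: inner_diff_right algebra_simps)
  qed
  then have "a = exp c * b" and "u = exp c *\<^sub>R v"
    using lin_indep_on_with_oneD[OF indep, of "a - exp c * b" "u - exp c *\<^sub>R v"] by auto
  then show "u /\<^sub>R a = v /\<^sub>R b" by simp
next
  assume eq: "u /\<^sub>R a = v /\<^sub>R b"
  \<comment> \<open>Factoring out \<open>a\<close> and \<open>b\<close> leaves a common factor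
    \<open>?q\<close>. As \<open>a\<close>, \<open>b\<close> and \<open>?q\<close> may be negative,
    it is cancelled inside the logarithm of the quotient; it is nonzero because
    \<open>a * ?q\<close> is positive.\<close>
  have "ln (a + w \<theta> \<bullet> u) - ln (b + w \<theta> \<bullet> v) = ln (a / b)" if "\<theta> \<in> D" for \<theta>
  proof -
    let ?q = "1 + w \<theta> \<bullet> (u /\<^sub>R a)"
    have "a + w \<theta> \<bullet> u = a * ?q"
      using \<open>a \<noteq> 0\<close> by (simp add: field_simps)
    moreover have "b + w \<theta> \<bullet> v = b * ?q"
      unfolding eq using \<open>b \<noteq> 0\<close> by (simp add: field_simps)
    moreover have "ln (a + w \<theta> \<bullet> u) - ln (b + w \<theta> \<bullet> v) = ln ((a + w \<theta> \<bullet> u) / (b + w \<theta> \<bullet> v))"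
      using u[OF that] v[OF that] by (simp add: ln_div)
    ultimately show ?thesis using u[OF that] by auto
  qed
  then show "\<exists>c. \<forall>\<theta>\<in>D. ln (a + w \<theta> \<bullet> u) - ln (b + w \<theta> \<bullet> v) = c" by blast
qed

lemma M_family_minimal_sufficient:
  assumes reg: "regular_M_family \<alpha> h w f \<Theta> S p" and "\<alpha> \<noteq> 1"
  shows "minimal_sufficient_statistic TYPE('u) (samples_nz h S) \<Theta> (jones_likelihood \<alpha> p)
    (\<lambda>x :: real ^ 'n. \<chi> i. sample_mean_vec f x $ i / sample_mean h x)"
proof (rule minimal_sufficient_statisticI)
  fix x y :: "real ^ 'n"
  assume "x \<in> samples_nz h S" and "y \<in> samples_nz h S"
  then have x: "x \<in> samples S" "sample_mean h x \<noteq> 0"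
    and y: "y \<in> samples S" "sample_mean h y \<noteq> 0"
    by (auto simp: samples_nz_def)
  let ?A = "\<lambda>x \<theta>. sample_mean h x + w \<theta> \<bullet> sample_mean_vec f x"
  have indep: "lin_indep_on \<Theta> (with_one w)"
    using reg by (simp add: regular_M_family_def)
  note jones = jones_likelihood_M_family[OF reg \<open>\<alpha> \<noteq> 1\<close>]
  have "jones_likelihood \<alpha> p x \<theta> - jones_likelihood \<alpha> p y \<theta>
      = (ln (?A x \<theta>) - ln (?A y \<theta>)) / (\<alpha> - 1)" if "\<theta> \<in> \<Theta>" for \<theta>
    using jones(2)[OF that x(1)] jones(2)[OF that y(1)] by (simp add: diff_divide_distrib)
  then have "(\<exists>c. \<forall>\<theta>\<in>\<Theta>. jones_likelihood \<alpha> p x \<theta> - jones_likelihood \<alpha> p y \<theta> = c)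
      \<longleftrightarrow> (\<exists>c. \<forall>\<theta>\<in>\<Theta>. (ln (?A x \<theta>) - ln (?A y \<theta>)) / (\<alpha> - 1) = c)"
    by simp
  also have "\<dots> \<longleftrightarrow> (\<exists>c. \<forall>\<theta>\<in>\<Theta>. ln (?A x \<theta>) - ln (?A y \<theta>) = c)"
    \<comment> \<open>Dividing by the nonzero constant \<open>\<alpha> - 1\<close> only rescales the
      witness \<open>c\<close>.\<close>
    using \<open>\<alpha> \<noteq> 1\<close> by (metis eq_iff_diff_eq_0 nonzero_eq_divide_eq)
  also have "\<dots> \<longleftrightarrow> sample_mean_vec f x /\<^sub>R sample_mean h x = sample_mean_vec f y /\<^sub>R sample_mean h y"
    by (rule ln_diff_const_iff[OF indep x(2) y(2) jones(1)[OF _ x(1)] jones(1)[OF _ y(1)]])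
  finally show "(\<chi> i. sample_mean_vec f x $ i / sample_mean h x)
      = (\<chi> i. sample_mean_vec f y $ i / sample_mean h y) \<longleftrightarrow>
    (\<exists>c. \<forall>\<theta>\<in>\<Theta>. jones_likelihood \<alpha> p x \<theta> - jones_likelihood \<alpha> p y \<theta> = c)"
    by (simp add: vec_eq_iff divide_inverse mult.commute)
qed

text \<open>The integral and \<open>F \<theta>\<close> are the same for both samples and cancel,
  leaving an affine form in \<open>w \<theta>\<close>.\<close>

lemma basu_likelihood_diff:
  fixes x y :: "real ^ 'n"
  assumes "B_family \<alpha> h w f \<Theta> S p" and "\<alpha> \<noteq> 1" and "\<theta> \<in> \<Theta>"
    and "x \<in> samples S" and "y \<in> samples S"
  shows "basu_likelihood \<alpha> p x \<theta> - basu_likelihood \<alpha> p y \<theta> =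
    \<alpha> / (\<alpha> - 1) * (sample_mean h x - sample_mean h y
      + w \<theta> \<bullet> (sample_mean_vec f x - sample_mean_vec f y))"
proof -
  obtain F where F: "\<And>t. t \<in> S \<Longrightarrow> 0 \<le> h t + F \<theta> + w \<theta> \<bullet> f t"
    "\<And>t. t \<in> S \<Longrightarrow> p \<theta> t = (h t + F \<theta> + w \<theta> \<bullet> f t) powr (1 / (\<alpha> - 1))"
    using assms(1,3) unfolding B_family_def by (metis (no_types, lifting))
  have pw: "p \<theta> t powr (\<alpha> - 1) = h t + F \<theta> + w \<theta> \<bullet> f t" if "t \<in> S" for t
    using F[OF that] \<open>\<alpha> \<noteq> 1\<close> by (simp add: powr_powr)
  have "sample_mean (\<lambda>t. (\<alpha> * p \<theta> t powr (\<alpha> - 1) - 1) / (\<alpha> - 1)) z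
      = \<alpha> / (\<alpha> - 1) * (sample_mean h z + F \<theta> + w \<theta> \<bullet> sample_mean_vec f z) + - 1 / (\<alpha> - 1)"
    if "z \<in> samples S" for z :: "real ^ 'n"
  proof -
    \<comment> \<open>The summand is recast as a multiple plus a constant, the shape to which
      linearity of the sample mean applies.\<close>
    have "sample_mean (\<lambda>t. (\<alpha> * p \<theta> t powr (\<alpha> - 1) - 1) / (\<alpha> - 1)) z
        = sample_mean (\<lambda>t. \<alpha> / (\<alpha> - 1) * (h t + F \<theta> + w \<theta> \<bullet> f t) + - 1 / (\<alpha> - 1)) z"
      by (rule sample_mean_cong[OF that]) (simp add: pw diff_divide_distrib)
    then show ?thesis
      by (simp only: sample_mean_add sample_mean_cmult sample_mean_const sample_mean_inner)
  qed
  note this[OF assms(4)] this[OF assms(5)]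
  then show ?thesis
    by (simp add: basu_likelihood_def inner_diff_right right_diff_distrib distrib_left
        add_divide_distrib diff_divide_distrib)
qed

lemma B_family_minimal_sufficient:
  assumes reg: "regular_B_family \<alpha> h w f \<Theta> S p" and "\<alpha> \<noteq> 0" and "\<alpha> \<noteq> 1"
  shows "minimal_sufficient_statistic TYPE('u) (samples S) \<Theta> (basu_likelihood \<alpha> p)
    (\<lambda>x :: real ^ 'n. sample_mean_vec f x)"
proof (rule minimal_sufficient_statisticI)
  fix x y :: "real ^ 'n"
  assume xy: "x \<in> samples S" "y \<in> samples S"
  let ?d = "sample_mean h x - sample_mean h y"
    and ?v = "sample_mean_vec f x - sample_mean_vec f y"
  have indep: "lin_indep_on \<Theta> (with_one w)" and fam: "B_family \<alpha> h w f \<Theta> S p"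
    using reg by (auto simp: regular_B_family_def)
  have diff: "basu_likelihood \<alpha> p x \<theta> - basu_likelihood \<alpha> p y \<theta> = \<alpha> / (\<alpha> - 1) * (?d + w \<theta> \<bullet> ?v)"
    if "\<theta> \<in> \<Theta>" for \<theta>
    by (rule basu_likelihood_diff[OF fam \<open>\<alpha> \<noteq> 1\<close> that xy])
  show "sample_mean_vec f x = sample_mean_vec f y \<longleftrightarrow>
    (\<exists>c. \<forall>\<theta>\<in>\<Theta>. basu_likelihood \<alpha> p x \<theta> - basu_likelihood \<alpha> p y \<theta> = c)"
  proof
    assume "sample_mean_vec f x = sample_mean_vec f y"
    then show "\<exists>c. \<forall>\<theta>\<in>\<Theta>. basu_likelihood \<alpha> p x \<theta> - basu_likelihood \<alpha> p y \<theta> = c"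
      using diff by simp
  next
    assume "\<exists>c. \<forall>\<theta>\<in>\<Theta>. basu_likelihood \<alpha> p x \<theta> - basu_likelihood \<alpha> p y \<theta> = c"
    then obtain c where c: "\<alpha> / (\<alpha> - 1) * (?d + w \<theta> \<bullet> ?v) = c" if "\<theta> \<in> \<Theta>" for \<theta>
      using diff by auto
    \<comment> \<open>Solving for the affine form moves the constant into the intercept, so
      independence forces the coefficient vector \<open>?v\<close> to vanish.\<close>
    have "(?d - c * (\<alpha> - 1) / \<alpha>) + w \<theta> \<bullet> ?v = 0" if "\<theta> \<in> \<Theta>" for \<theta>
      using \<open>\<alpha> \<noteq> 0\<close> \<open>\<alpha> \<noteq> 1\<close> by (simp add: c[OF that, symmetric])
    then have "?v = 0"
      by (rule lin_indep_on_with_oneD(2)[OF indep])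
    then show "sample_mean_vec f x = sample_mean_vec f y" by simp
  qed
qed

theorem theorem12:
  fixes \<alpha> :: real
    and h :: "real \<Rightarrow> real"
    and w :: "real ^ 'k \<Rightarrow> real ^ 's"
    and f :: "real \<Rightarrow> real ^ 's"
    and \<Theta> :: "(real ^ 'k) set"
    and S :: "real set"
    and p :: "real ^ 'k \<Rightarrow> real \<Rightarrow> real"
  assumes "\<alpha> > 0" and "\<alpha> \<noteq> 1"
  shows "(regular_M_family \<alpha> h w f \<Theta> S p \<longrightarrow>
            minimal_sufficient_statistic TYPE('u) (samples_nz h S) \<Theta> (jones_likelihood \<alpha> p)
              (\<lambda>x :: real ^ 'n. \<chi> i. sample_mean_vec f x $ i / sample_mean h x)) \<and>
         (regular_B_family \<alpha> h w f \<Theta> S p \<longrightarrow>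
            minimal_sufficient_statistic TYPE('u) (samples S) \<Theta> (basu_likelihood \<alpha> p)
              (\<lambda>x :: real ^ 'n. sample_mean_vec f x))"
  using assms M_family_minimal_sufficient B_family_minimal_sufficient by blast

end
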